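(* The following three-variable generating function holds for the set $\mathcal S_2$ of overpartitions defined in the context: $$\sum_{\lambda\in\mathcal{S}_2}a^{\overline{\#}(\lambda)}z^{\lceil \#(\lambda)/2\rceil}q^{|\lambda|}=\sum_{n=0}^{\infty}\frac{(-aq;q^2)_{n}\,z^n\,q^{n^2}}{(q;q)_{2n}}.$$
   Context: $(a;q)_n:=\prod_{j=0}^{n-1}(1-aq^j)$ for $n\ge 0$ (and similarly for base $q^2$). The identity may be read as an identity of formal power series in $q$ with coefficients in $\mathbb Z[a,z]$. A partition is a finite non-increasing sequence $\lambda=(\lambda_1,\ldots,\lambda_\ell)$ of positive integers (the empty partition is allowed). An overpartition is a partition in which the last appearance of each part size may be overlined. $|\lambda|$ is the sum of the parts, $\#(\lambda)=\ell$ the number of parts, and $\overline{\#}(\lambda)$ the number of overlined parts. $\mathcal S_2$ is the set of overpartitions $\lambda=(\lambda_1,\ldots,\lambda_\ell)$ such that: (1) only odd-indexed parts $\lambda_{2i-1}$ may be overlined; (2) for every $i\ge1$ with $2i-1\le \ell$, $\lambda_{2i-1}-\lambda_{2i}\ge 1$, and $\lambda_{2i-1}-\lambda_{2i}\ge 2$ if $\lambda_{2i-1}$ is overlined, where differences refer to numerical sizes and $\lambda_{\ell+1}:=0$. *)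

theory Defs
  imports "HOL-Analysis.Infinite_Sum" "HOL-Computational_Algebra.Formal_Power_Series"
    "HOL-Computational_Algebra.Polynomial"
begin

(* (a; q)_n; the base q^2 is obtained by substituting q^2 for q. *)
definition qpoch :: "'a::comm_ring_1 \<Rightarrow> 'a \<Rightarrow> nat \<Rightarrow> 'a"
  where "qpoch a q n = (\<Prod>j<n. 1 - a * q ^ j)"


(* An entry (m, b) is a part of numerical size m, overlined iff b. *)
type_synonym marked_list = "(nat \<times> bool) list"

(* Parts are indexed from 1, and the size is 0 beyond the last part, so that
   part_size l (length l + 1) = 0. *)
definition part_size :: "marked_list \<Rightarrow> nat \<Rightarrow> nat"
  where "part_size l i = (if 1 \<le> i \<and> i \<le> length l then fst (l ! (i - 1)) else 0)"

definition overlined :: "marked_list \<Rightarrow> nat \<Rightarrow> bool"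
  where "overlined l i \<longleftrightarrow> 1 \<le> i \<and> i \<le> length l \<and> snd (l ! (i - 1))"

definition overpartition :: "marked_list \<Rightarrow> bool"
  where "overpartition l \<longleftrightarrow>
    (\<forall>i\<in>{1..length l}. part_size l i > 0) \<and>
    (\<forall>i\<in>{1..length l}. \<forall>j\<in>{1..length l}. i \<le> j \<longrightarrow> part_size l j \<le> part_size l i) \<and>
    (\<forall>i\<in>{1..length l}. \<forall>j\<in>{1..length l}.
       overlined l i \<and> i < j \<longrightarrow> part_size l j \<noteq> part_size l i)"

definition weight :: "marked_list \<Rightarrow> nat"
  where "weight l = (\<Sum>i=1..length l. part_size l i)"

definition num_parts :: "marked_list \<Rightarrow> nat"
  where "num_parts l = length l"

definition num_overlined :: "marked_list \<Rightarrow> nat"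
  where "num_overlined l = card {i\<in>{1..length l}. overlined l i}"

definition S2 :: "marked_list set"
  where "S2 = {l. overpartition l \<and>
    (\<forall>i\<in>{1..length l}. overlined l i \<longrightarrow> odd i) \<and>
    (\<forall>i\<ge>1. 2 * i - 1 \<le> length l \<longrightarrow>
       int (part_size l (2 * i - 1)) - int (part_size l (2 * i)) \<ge> 1 \<and>
       (overlined l (2 * i - 1) \<longrightarrow>
          int (part_size l (2 * i - 1)) - int (part_size l (2 * i)) \<ge> 2))}"


(* The ring Z[a,z][[q]], with Z[a,z] realised as Z[a][z]: the outer polynomial variable
   is z and the inner one is a. *)
type_synonym azq_series = "int poly poly fps"

definition var_a :: azq_series
  where "var_a = fps_const [:[:0, 1:]:]"

definition var_z :: azq_series
  where "var_z = fps_const [:0, 1:]"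

definition var_q :: azq_series
  where "var_q = fps_X"

(* The coefficient ring is not a field, so reciprocals are taken with fps_right_inverse,
   whose second argument is the inverse of the constant coefficient. *)
definition recip :: "azq_series \<Rightarrow> azq_series"
  where "recip f = fps_right_inverse f 1"

lemma recip_qpoch: "qpoch var_q var_q n * recip (qpoch var_q var_q n) = 1"
proof -
  have "fps_nth (qpoch var_q var_q n) 0 = 1"
    by (induction n) (simp_all add: qpoch_def var_q_def fps_mult_nth_0)
  then show ?thesis
    unfolding recip_def by (intro fps_right_inverse) simp
qed

end

theory Submission
  imports Defs
begin

text \<open>
  Pad a member of \<open>S\<^sub>2\<close> with a zero part if necessary, so that it has \<open>2n\<close> parts
  \<open>\<lambda>\<^sub>1 > \<lambda>\<^sub>2 \<ge> \<lambda>\<^sub>3 > \<lambda>\<^sub>4 \<ge> \<dots> > \<lambda>\<^sub>2\<^sub>n \<ge> 0\<close>. The consecutive differences (with \<open>\<lambda>\<^sub>2\<^sub>n\<close> as the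
  last one) are independent of each other, and the \<open>k\<close>-th contributes \<open>k\<close> times its value to the
  weight. Even \<open>k\<close> gives the factor \<open>1 / (1 - q\<^sup>k)\<close>; odd \<open>k\<close>, where the difference is at least 1,
  or at least 2 if overlined, gives \<open>q\<^sup>k (1 + a q\<^sup>k) / (1 - q\<^sup>k)\<close>. The product of these over
  \<open>k = 1, \<dots>, 2n\<close>, times \<open>z\<^sup>n\<close>, is the \<open>n\<close>-th term of the right-hand side.
\<close>

section \<open>Weighted generating functions\<close>

text \<open>This keeps each coefficient of \<open>gf\<close> a genuine finite sum: a sum over an
  infinite set would take the default value 0.\<close>

definition finite_fibres :: "('i \<Rightarrow> nat) \<Rightarrow> 'i set \<Rightarrow> bool"
  where "finite_fibres w A \<longleftrightarrow> (\<forall>N. finite {x\<in>A. w x = N})"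

definition gf :: "('i \<Rightarrow> 'a::comm_ring_1) \<Rightarrow> ('i \<Rightarrow> nat) \<Rightarrow> 'i set \<Rightarrow> 'a fps"
  where "gf c w A = Abs_fps (\<lambda>N. \<Sum>x\<in>{x\<in>A. w x = N}. c x)"

lemma gf_nth [simp]: "fps_nth (gf c w A) N = (\<Sum>x\<in>{x\<in>A. w x = N}. c x)"
  by (simp add: gf_def)

text \<open>Convergence of formal power series is coefficientwise, and each coefficient meets only
  one finite fibre. This links \<open>gf\<close> to the infinite sum in the theorem.\<close>

lemma gf_has_sum:
  assumes "finite_fibres w A"
  shows "((\<lambda>x. fps_const (c x) * fps_X ^ w x) has_sum gf c w A) A"
proof (rule has_sum_fpsI)
  fix N
  have fin: "finite {x\<in>A. w x = N}"
    using assms by (simp add: finite_fibres_def)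
  have nth: "fps_nth (fps_const (c x) * fps_X ^ w x) N = (if w x = N then c x else 0)" for x
    by (auto simp: fps_X_power_iff)
  have eq: "{x\<in>A. fps_nth (fps_const (c x) * fps_X ^ w x) N \<noteq> 0} =
      {x\<in>{x\<in>A. w x = N}. c x \<noteq> 0}"
    unfolding nth by auto
  show "finite {x\<in>A. fps_nth (fps_const (c x) * fps_X ^ w x) N \<noteq> 0}"
    unfolding eq by (rule finite_subset[OF _ fin]) auto
  have "fps_nth (gf c w A) N = (\<Sum>x\<in>{x\<in>{x\<in>A. w x = N}. c x \<noteq> 0}. c x)"
    unfolding gf_nth by (rule sum.mono_neutral_right) (use fin in auto)
  also have "\<dots> = (\<Sum>x | x \<in> A \<and> fps_nth (fps_const (c x) * fps_X ^ w x) N \<noteq> 0.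
      fps_nth (fps_const (c x) * fps_X ^ w x) N)"
    unfolding eq nth by (rule sum.cong) auto
  finally show "fps_nth (gf c w A) N = \<dots>" .
qed

lemma finite_fibres_cong:
  assumes "\<And>x. x \<in> A \<Longrightarrow> w x = w' x"
  shows "finite_fibres w A \<longleftrightarrow> finite_fibres w' A"
proof -
  have "{x\<in>A. w x = N} = {x\<in>A. w' x = N}" for N
    using assms by auto
  then show ?thesis
    by (simp add: finite_fibres_def)
qed

lemma bij_betw_fibre:
  assumes "bij_betw f A B"
  shows "bij_betw f {x\<in>A. w (f x) = N} {y\<in>B. w y = N}"
  by (rule bij_betw_subset[OF assms]) (use assms in \<open>auto simp: bij_betw_def\<close>)

lemma finite_fibres_reindex:
  assumes "bij_betw f A B"
  shows "finite_fibres (\<lambda>x. w (f x)) A \<longleftrightarrow> finite_fibres w B"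
  unfolding finite_fibres_def
  by (intro all_cong1 bij_betw_finite[OF bij_betw_fibre[OF assms, of w]])

lemma gf_reindex:
  assumes "bij_betw f A B"
  shows "gf (\<lambda>x. c (f x)) (\<lambda>x. w (f x)) A = gf c w B"
  by (rule fps_ext, unfold gf_nth)
    (rule sum.reindex_bij_betw[OF bij_betw_fibre[OF assms, of w], of c])

lemma gf_cong:
  assumes "A = B" "\<And>x. x \<in> B \<Longrightarrow> c x = c' x" "\<And>x. x \<in> B \<Longrightarrow> w x = w' x"
  shows "gf c w A = gf c' w' B"
proof (rule fps_ext)
  fix N
  have "{x\<in>A. w x = N} = {x\<in>B. w' x = N}"
    using assms(1,3) by auto
  then show "fps_nth (gf c w A) N = fps_nth (gf c' w' B) N"
    unfolding gf_nth by (rule sum.cong) (use assms(2) in auto)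
qed

lemma gf_shift:
  "gf (\<lambda>x. b * c x) (\<lambda>x. k + w x) A = fps_const b * fps_X ^ k * gf c w A"
proof (rule fps_ext)
  fix N
  have "{x\<in>A. k + w x = N} = (if N < k then {} else {x\<in>A. w x = N - k})"
    by auto
  then show "fps_nth (gf (\<lambda>x. b * c x) (\<lambda>x. k + w x) A) N =
      fps_nth (fps_const b * fps_X ^ k * gf c w A) N"
    by (simp add: mult.assoc fps_X_power_mult_nth sum_distrib_left)
qed

lemma gf_Un_disjoint:
  assumes "finite_fibres w A" "finite_fibres w B" "A \<inter> B = {}"
  shows "gf c w (A \<union> B) = gf c w A + gf c w B"
proof (rule fps_ext)
  fix N
  have "{x\<in>A \<union> B. w x = N} = {x\<in>A. w x = N} \<union> {x\<in>B. w x = N}"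
    by auto
  moreover have "sum c ({x\<in>A. w x = N} \<union> {x\<in>B. w x = N}) =
      sum c {x\<in>A. w x = N} + sum c {x\<in>B. w x = N}"
    by (rule sum.union_disjoint) (use assms in \<open>auto simp: finite_fibres_def\<close>)
  ultimately show "fps_nth (gf c w (A \<union> B)) N = fps_nth (gf c w A + gf c w B) N"
    by simp
qed

lemma fibre_Times:
  fixes w :: "'i \<Rightarrow> nat"
  shows "{p\<in>{p\<in>A \<times> B. w (fst p) + w' (snd p) = N}. w (fst p) = i} =
    (if i \<le> N then {x\<in>A. w x = i} \<times> {y\<in>B. w' y = N - i} else {})"
  by auto

lemma finite_fibres_Times:
  assumes "finite_fibres w A" "finite_fibres w' B"
  shows "finite_fibres (\<lambda>p. w (fst p) + w' (snd p)) (A \<times> B)"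
  unfolding finite_fibres_def
proof
  fix N
  have "{p\<in>A \<times> B. w (fst p) + w' (snd p) = N} =
      (\<Union>i\<le>N. {x\<in>A. w x = i} \<times> {y\<in>B. w' y = N - i})"
    by auto
  then show "finite {p\<in>A \<times> B. w (fst p) + w' (snd p) = N}"
    using assms by (auto simp: finite_fibres_def)
qed

text \<open>Grouping the pairs of total weight \<open>N\<close> by the weight \<open>i\<close> of
  the first component cuts their set into rectangles, whose sums are the terms of the Cauchy
  product.\<close>

lemma gf_Times:
  assumes "finite_fibres w A" "finite_fibres w' B"
  shows "gf (\<lambda>p. c (fst p) * c' (snd p)) (\<lambda>p. w (fst p) + w' (snd p)) (A \<times> B) =
    gf c w A * gf c' w' B"
proof (rule fps_ext)
  fix N
  let ?P = "{p\<in>A \<times> B. w (fst p) + w' (snd p) = N}"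
  have "(\<Sum>p\<in>?P. c (fst p) * c' (snd p)) =
      (\<Sum>i\<in>{0..N}. \<Sum>p\<in>{p\<in>?P. w (fst p) = i}. c (fst p) * c' (snd p))"
    by (rule sum.group[symmetric])
      (use finite_fibres_Times[OF assms] in \<open>auto simp: finite_fibres_def\<close>)
  also have "\<dots> = (\<Sum>i=0..N. fps_nth (gf c w A) i * fps_nth (gf c' w' B) (N - i))"
    unfolding fibre_Times
    by (rule sum.cong) (auto simp: sum_product sum.cartesian_product case_prod_beta)
  finally show "fps_nth (gf (\<lambda>p. c (fst p) * c' (snd p)) (\<lambda>p. w (fst p) + w' (snd p)) (A \<times> B)) N =
      fps_nth (gf c w A * gf c' w' B) N"
    by (simp add: fps_mult_nth)
qed

text \<open>Since \<open>p\<close> is bounded by \<open>w\<close>, the coefficient at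
  \<open>N\<close> only sees grades up to \<open>N\<close>, so its partial sums are constant beyond
  \<open>N\<close>.\<close>

lemma gf_graded_sums:
  assumes fin: "finite_fibres w A" and le: "\<And>x. x \<in> A \<Longrightarrow> p x \<le> w x"
  shows "(\<lambda>n. gf c w {x\<in>A. p x = n}) sums gf c w A"
  unfolding sums_def
proof (rule tendsto_fpsI)
  fix N
  have "fps_nth (\<Sum>n<M. gf c w {x\<in>A. p x = n}) N = fps_nth (gf c w A) N" if "M > N" for M
  proof -
    have "p x < M" if "x \<in> A" "w x = N" for x
      using le[OF that(1)] that(2) \<open>M > N\<close> by simp
    moreover have "finite {x\<in>A. w x = N}"
      using fin by (simp add: finite_fibres_def)
    ultimately have "(\<Sum>n<M. \<Sum>x\<in>{x\<in>{x\<in>A. w x = N}. p x = n}. c x) = sum c {x\<in>A. w x = N}"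
      by (intro sum.group) auto
    moreover have "{x\<in>{x\<in>A. p x = n}. w x = N} = {x\<in>{x\<in>A. w x = N}. p x = n}" for n
      by auto
    ultimately show ?thesis
      by (simp add: fps_sum_nth)
  qed
  then show "eventually (\<lambda>M. fps_nth (\<Sum>n<M. gf c w {x\<in>A. p x = n}) N = fps_nth (gf c w A) N)
      sequentially"
    by (auto simp: eventually_at_top_dense)
qed


section \<open>Column multiplicities\<close>

type_synonym column = "(nat \<times> bool) \<times> nat"

text \<open>
  An entry \<open>((d, m), e)\<close> at position \<open>i\<close> (from 0) stands for \<open>d = \<lambda>\<^sub>2\<^sub>i\<^sub>+\<^sub>1 - \<lambda>\<^sub>2\<^sub>i\<^sub>+\<^sub>2\<close>,
  \<open>e = \<lambda>\<^sub>2\<^sub>i\<^sub>+\<^sub>2 - \<lambda>\<^sub>2\<^sub>i\<^sub>+\<^sub>3\<close>, and \<open>m\<close> records whether \<open>\<lambda>\<^sub>2\<^sub>i\<^sub>+\<^sub>1\<close> is overlined.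
\<close>
definition odd_gaps :: "(nat \<times> bool) set"
  where "odd_gaps = {(d, m). (if m then 2 else 1) \<le> d}"

definition columns :: "column set"
  where "columns = odd_gaps \<times> UNIV"

definition column_weight :: "nat \<Rightarrow> column \<Rightarrow> nat"
  where "column_weight i t = (2 * i + 1) * fst (fst t) + (2 * i + 2) * snd t"

definition columns_weight :: "column list \<Rightarrow> nat"
  where "columns_weight ts = (\<Sum>i<length ts. column_weight i (ts ! i))"

text \<open>The largest part: the differences telescope down to 0.\<close>

definition height :: "column list \<Rightarrow> nat"
  where "height ts = (\<Sum>t\<leftarrow>ts. fst (fst t) + snd t)"

lemma height_simps [simp]:
  "height [] = 0" "height (t # ts) = fst (fst t) + snd t + height ts"
  by (simp_all add: height_def)

lemma columns_weight_Nil [simp]: "columns_weight [] = 0"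
  by (simp add: columns_weight_def)

lemma columns_weight_snoc:
  "columns_weight (ts @ [t]) = columns_weight ts + column_weight (length ts) t"
  by (simp add: columns_weight_def nth_append)

text \<open>Prepending a column moves the later ones by one position, so each unit in them is
  counted in two more parts. \<open>stack\<close> recurses from the front and needs this form; the
  generating function recursion appends, which keeps positions fixed.\<close>

lemma columns_weight_Cons:
  "columns_weight (t # ts) = column_weight 0 t + columns_weight ts + 2 * height ts"
proof -
  have "column_weight (Suc i) u = column_weight i u + 2 * (fst (fst u) + snd u)" for i u
    by (simp add: column_weight_def algebra_simps)
  moreover have "height ts = (\<Sum>i<length ts. fst (fst (ts ! i)) + snd (ts ! i))"
    by (simp add: height_def sum_list_sum_nth atLeast0LessThan)
  ultimately show ?thesis
    by (simp add: columns_weight_def sum.lessThan_Suc_shift sum.distrib sum_distrib_left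
        del: sum.lessThan_Suc)
qed

section \<open>The generating function of one column\<close>

lemma gf_multiples:
  assumes "k > 0"
  shows "finite_fibres (\<lambda>e. k * e) UNIV"
    and "gf (\<lambda>_. 1) (\<lambda>e. k * e) UNIV * (1 - fps_X ^ k) = (1 :: 'a::comm_ring_1 fps)"
proof -
  have fin: "finite_fibres (\<lambda>e. k * e) B" for B
    unfolding finite_fibres_def
  proof
    fix N
    have "{e\<in>B. k * e = N} \<subseteq> {..N}"
      using assms by auto
    then show "finite {e\<in>B. k * e = N}"
      using finite_subset by blast
  qed
  show "finite_fibres (\<lambda>e. k * e) UNIV"
    by (rule fin)
  let ?G = "gf (\<lambda>_. 1) (\<lambda>e. k * e) UNIV :: 'a fps"
  have zero: "gf (\<lambda>_. 1) (\<lambda>e. k * e) {0} = (1 :: 'a fps)"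
    by (rule fps_ext) (auto simp: Collect_conv_if)
  \<comment> \<open>Geometric series: \<open>e = 0\<close> contributes 1 and the rest is the whole
    set shifted by \<open>k\<close>, so \<open>?G = 1 + fps_X ^ k * ?G\<close>.\<close>
  have UNIV_eq: "UNIV = {0} \<union> range Suc"
    using not0_implies_Suc by auto
  have "?G = gf (\<lambda>_. 1) (\<lambda>e. k * e) ({0} \<union> range Suc)"
    using UNIV_eq by simp
  also have "\<dots> = 1 + gf (\<lambda>_. 1) (\<lambda>e. k * e) (range Suc)"
    by (subst gf_Un_disjoint) (auto simp: fin zero)
  also have "gf (\<lambda>_. 1) (\<lambda>e. k * e) (range Suc) = gf (\<lambda>_. 1 * 1) (\<lambda>e. k + k * e) UNIV"
    by (subst gf_reindex[of Suc UNIV, symmetric]) (auto simp: bij_betw_def)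
  also have "\<dots> = fps_X ^ k * ?G"
    by (subst gf_shift) simp
  finally show "?G * (1 - fps_X ^ k) = 1"
    by (simp add: algebra_simps)
qed

lemma gf_odd_gaps:
  fixes \<alpha> :: "'a::comm_ring_1"
  assumes "k > 0"
  shows "finite_fibres (\<lambda>p. k * fst p) odd_gaps"
    and "gf (\<lambda>p. if snd p then \<alpha> else 1) (\<lambda>p. k * fst p) odd_gaps * (1 - fps_X ^ k) =
      fps_X ^ k * (1 + fps_const \<alpha> * fps_X ^ k)"
proof -
  let ?G = "gf (\<lambda>_. 1) (\<lambda>e. k * e) UNIV :: 'a fps"
  let ?w = "\<lambda>p :: nat \<times> bool. k * fst p" and ?c = "\<lambda>p :: nat \<times> bool. if snd p then \<alpha> else 1"
  \<comment> \<open>Unmarked gaps start at 1 and marked ones at 2; each family is a shifted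
    geometric series.\<close>
  let ?f = "\<lambda>e. (e + 1, False)" and ?g = "\<lambda>e. (e + 2, True)"
  have fin: "finite_fibres ?w B" for B
    unfolding finite_fibres_def
  proof
    fix N
    have "{p\<in>B. ?w p = N} \<subseteq> {..N} \<times> UNIV"
      using assms by auto
    then show "finite {p\<in>B. ?w p = N}"
      by (rule finite_subset) auto
  qed
  show "finite_fibres (\<lambda>p. k * fst p) odd_gaps"
    by (rule fin)
  have "odd_gaps = range ?f \<union> range ?g"
  proof (intro equalityI subsetI)
    fix p :: "nat \<times> bool"
    assume p: "p \<in> odd_gaps"
    show "p \<in> range ?f \<union> range ?g"
    proof (cases "snd p")
      case True
      with p have "p = ?g (fst p - 2)"
        by (auto simp: odd_gaps_def)
      then show ?thesis by blast
    next
      case False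
      with p have "p = ?f (fst p - 1)"
        by (auto simp: odd_gaps_def)
      then show ?thesis by blast
    qed
  qed (auto simp: odd_gaps_def)
  then have "gf ?c ?w odd_gaps = gf ?c ?w (range ?f) + gf ?c ?w (range ?g)"
    using gf_Un_disjoint[OF fin fin, of "range ?f" "range ?g" ?c] by auto
  also have "gf ?c ?w (range ?f) = gf (\<lambda>_. 1 * 1) (\<lambda>e. k + k * e) UNIV"
    by (subst gf_reindex[of ?f UNIV, symmetric]) (auto simp: bij_betw_def inj_on_def)
  also have "\<dots> = fps_X ^ k * ?G"
    by (subst gf_shift) simp
  also have "gf ?c ?w (range ?g) = gf (\<lambda>_. \<alpha> * 1) (\<lambda>e. 2 * k + k * e) UNIV"
    by (subst gf_reindex[of ?g UNIV, symmetric])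
      (auto simp: bij_betw_def inj_on_def algebra_simps intro!: gf_cong)
  also have "\<dots> = fps_const \<alpha> * fps_X ^ (2 * k) * ?G"
    by (rule gf_shift)
  finally have "gf ?c ?w odd_gaps * (1 - fps_X ^ k) =
      (fps_X ^ k + fps_const \<alpha> * fps_X ^ (2 * k)) * (?G * (1 - fps_X ^ k))"
    by (simp add: algebra_simps)
  also have "\<dots> = fps_X ^ k * (1 + fps_const \<alpha> * fps_X ^ k)"
    unfolding gf_multiples(2)[OF assms] mult_2 power_add by (simp add: distrib_left mult_ac)
  finally show "gf ?c ?w odd_gaps * (1 - fps_X ^ k) = fps_X ^ k * (1 + fps_const \<alpha> * fps_X ^ k)" .
qed

definition column_coeff :: "'a::comm_ring_1 \<Rightarrow> column \<Rightarrow> 'a"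
  where "column_coeff \<alpha> t = (if snd (fst t) then \<alpha> else 1)"

text \<open>The gaps \<open>d\<close> and \<open>e\<close> are chosen independently, so their series
  multiply. Denominators are cleared, so that any commutative ring of coefficients is
  allowed.\<close>

lemma gf_columns:
  fixes \<alpha> :: "'a::comm_ring_1"
  shows "finite_fibres (column_weight n) columns"
    and "gf (column_coeff \<alpha>) (column_weight n) columns *
        ((1 - fps_X ^ (2 * n + 1)) * (1 - fps_X ^ (2 * n + 2))) =
      fps_X ^ (2 * n + 1) * (1 + fps_const \<alpha> * fps_X ^ (2 * n + 1))"
proof -
  have pos: "2 * n + 1 > 0" "2 * n + 2 > 0"
    by simp_all
  note D = gf_odd_gaps[OF pos(1)] and E = gf_multiples[OF pos(2)]
  have w: "column_weight n = (\<lambda>t. (2 * n + 1) * fst (fst t) + (2 * n + 2) * snd t)"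
    by (simp add: column_weight_def fun_eq_iff)
  show "finite_fibres (column_weight n) columns"
    unfolding w columns_def by (rule finite_fibres_Times[OF D(1) E(1)])
  let ?D = "gf (\<lambda>p. if snd p then \<alpha> else 1) (\<lambda>p. (2 * n + 1) * fst p) odd_gaps"
  let ?E = "gf (\<lambda>_. 1) (\<lambda>e. (2 * n + 2) * e) UNIV :: 'a fps"
  have c: "column_coeff \<alpha> = (\<lambda>t. (if snd (fst t) then \<alpha> else 1) * 1)"
    by (simp add: column_coeff_def fun_eq_iff)
  have "gf (column_coeff \<alpha>) (column_weight n) columns = ?D * ?E"
    unfolding c w columns_def by (rule gf_Times[OF D(1) E(1)])
  then have "gf (column_coeff \<alpha>) (column_weight n) columns *
        ((1 - fps_X ^ (2 * n + 1)) * (1 - fps_X ^ (2 * n + 2))) =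
      (?D * (1 - fps_X ^ (2 * n + 1))) * (?E * (1 - fps_X ^ (2 * n + 2)))"
    by (simp only: mult_ac)
  also have "\<dots> = fps_X ^ (2 * n + 1) * (1 + fps_const \<alpha> * fps_X ^ (2 * n + 1))"
    unfolding D(2) E(2) by simp
  finally show "gf (column_coeff \<alpha>) (column_weight n) columns *
        ((1 - fps_X ^ (2 * n + 1)) * (1 - fps_X ^ (2 * n + 2))) =
      fps_X ^ (2 * n + 1) * (1 + fps_const \<alpha> * fps_X ^ (2 * n + 1))" .
qed

section \<open>Lists of n columns and the q-Pochhammer symbols\<close>

definition columns_coeff :: "'a::comm_ring_1 \<Rightarrow> column list \<Rightarrow> 'a"
  where "columns_coeff \<alpha> ts = (\<Prod>t\<leftarrow>ts. column_coeff \<alpha> t)"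

abbreviation column_lists :: "nat \<Rightarrow> column list set"
  where "column_lists n \<equiv> {ts \<in> lists columns. length ts = n}"

lemma column_lists_0: "column_lists 0 = {[]}"
  by auto

lemma bij_betw_snoc:
  "bij_betw (\<lambda>p. fst p @ [snd p]) (column_lists n \<times> columns) (column_lists (Suc n))"
  by (rule bij_betw_byWitness[where f' = "\<lambda>ts. (butlast ts, last ts)"])
    (auto simp: length_Suc_conv_rev)

lemma finite_fibres_column_lists: "finite_fibres columns_weight (column_lists n)"
proof (induction n)
  case 0
  show ?case
    unfolding column_lists_0 by (simp add: finite_fibres_def)
next
  case (Suc n)
  show ?case
  proof -
    let ?f = "\<lambda>p :: column list \<times> column. fst p @ [snd p]"
    have fin: "finite_fibres (\<lambda>p. columns_weight (fst p) + column_weight n (snd p))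
        (column_lists n \<times> columns)"
      by (rule finite_fibres_Times[OF Suc.IH gf_columns(1)])
    have w: "columns_weight (?f p) = columns_weight (fst p) + column_weight n (snd p)"
      if "p \<in> column_lists n \<times> columns" for p
    proof -
      have "length (fst p) = n"
        using that by auto
      then show ?thesis
        by (simp add: columns_weight_snoc)
    qed
    have "finite_fibres (\<lambda>p. columns_weight (?f p)) (column_lists n \<times> columns) \<longleftrightarrow>
        finite_fibres (\<lambda>p. columns_weight (fst p) + column_weight n (snd p)) (column_lists n \<times> columns)"
      by (rule finite_fibres_cong) (rule w)
    with fin have "finite_fibres (\<lambda>p. columns_weight (?f p)) (column_lists n \<times> columns)"
      by blast
    then show ?thesis
      unfolding finite_fibres_reindex[OF bij_betw_snoc] .
  qed
qed

text \<open>Appending column \<open>n\<close> multiplies by the series of \<open>gf_columns\<close>: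
  it adds two factors to the denominator and one to the numerator.\<close>

lemma gf_column_lists:
  fixes \<alpha> :: "'a::comm_ring_1"
  shows "gf (columns_coeff \<alpha>) columns_weight (column_lists n) * qpoch fps_X fps_X (2 * n) =
      qpoch (- fps_const \<alpha> * fps_X) (fps_X ^ 2) n * fps_X ^ (n ^ 2)"
proof (induction n)
  case 0
  have "gf (columns_coeff \<alpha>) columns_weight {[]} = 1"
    by (rule fps_ext) (auto simp: Collect_conv_if columns_coeff_def)
  then show ?case
    unfolding column_lists_0 by (simp add: qpoch_def)
next
  case (Suc n)
  let ?G = "gf (columns_coeff \<alpha>) columns_weight"
  let ?C = "gf (column_coeff \<alpha>) (column_weight n) columns"
  let ?X = "fps_X :: 'a fps"
  let ?D = "(1 - ?X ^ (2 * n + 1)) * (1 - ?X ^ (2 * n + 2))"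
  let ?num = "qpoch (- fps_const \<alpha> * ?X) (?X ^ 2)"
  have swap: "(u * v) * (w * x) = (u * w) * (v * x)" for u v w x :: "'a fps"
    by (simp only: mult_ac)
  have "?G (column_lists (Suc n)) = gf (\<lambda>p. columns_coeff \<alpha> (fst p @ [snd p]))
      (\<lambda>p. columns_weight (fst p @ [snd p])) (column_lists n \<times> columns)"
    by (rule gf_reindex[OF bij_betw_snoc, symmetric])
  also have "\<dots> = gf (\<lambda>p. columns_coeff \<alpha> (fst p) * column_coeff \<alpha> (snd p))
      (\<lambda>p. columns_weight (fst p) + column_weight n (snd p)) (column_lists n \<times> columns)"
    by (rule gf_cong) (auto simp: columns_weight_snoc columns_coeff_def)
  also have "\<dots> = ?G (column_lists n) * ?C"
    by (rule gf_Times[OF finite_fibres_column_lists gf_columns(1)])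
  finally have G: "?G (column_lists (Suc n)) = ?G (column_lists n) * ?C" .
  have Q: "qpoch ?X ?X (2 * Suc n) = qpoch ?X ?X (2 * n) * ?D"
    by (simp add: qpoch_def mult.assoc)
  have N: "?num (Suc n) = ?num n * (1 + fps_const \<alpha> * ?X ^ (2 * n + 1))"
    by (simp add: qpoch_def power_mult[symmetric] mult_ac flip: fps_const_neg)
  \<comment> \<open>The minimal odd gaps contribute the exponents 1, 3, 5, ..., which sum to a
    square.\<close>
  have "Suc n ^ 2 = n ^ 2 + (2 * n + 1)"
    by (simp add: power2_eq_square)
  then have P: "?X ^ (Suc n ^ 2) = ?X ^ (n ^ 2) * ?X ^ (2 * n + 1)"
    by (simp only: power_add)
  have "?G (column_lists (Suc n)) * qpoch ?X ?X (2 * Suc n) =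
      (?G (column_lists n) * qpoch ?X ?X (2 * n)) * (?C * ?D)"
    unfolding G Q by (rule swap)
  also have "\<dots> = ?num (Suc n) * ?X ^ (Suc n ^ 2)"
    unfolding Suc.IH gf_columns(2) N P mult.commute[of "?X ^ (2 * n + 1)"] by (rule swap)
  finally show ?case .
qed


section \<open>Overpartitions as stacks of columns\<close>

fun top_size :: "marked_list \<Rightarrow> nat" where
  "top_size [] = 0"
| "top_size ((x, _) # _) = x"

text \<open>A recursive form of \<open>S2\<close> that consumes two parts at a time, as
  \<open>stack\<close> produces them. In the singleton case the last part is compared with the
  padding zero.\<close>

fun paired :: "marked_list \<Rightarrow> bool" where
  "paired [] \<longleftrightarrow> True"
| "paired [(x, m)] \<longleftrightarrow> (if m then 2 else 1) \<le> x"
| "paired ((x, m) # (y, b) # r) \<longleftrightarrow>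
    \<not> b \<and> y > 0 \<and> y + (if m then 2 else 1) \<le> x \<and> top_size r \<le> y \<and> paired r"

text \<open>The final part \<open>\<lambda>\<^sub>2\<^sub>n\<close> is dropped when it is the padding zero.\<close>
fun stack :: "column list \<Rightarrow> marked_list" where
  "stack [] = []"
| "stack (((d, m), e) # ts) =
    (if ts = [] \<and> e = 0 then [(d, m)]
     else (d + e + height ts, m) # (e + height ts, False) # stack ts)"

fun gaps :: "marked_list \<Rightarrow> column list" where
  "gaps [] = []"
| "gaps [(x, m)] = [((x, m), 0)]"
| "gaps ((x, m) # (y, b) # r) = ((x - y, m), y - top_size r) # gaps r"

lemma top_size_stack [simp]: "top_size (stack ts) = height ts"
  by (induction ts rule: stack.induct) auto

text \<open>Every column has \<open>d\<close> at least 1. Hence the even-indexed part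
  \<open>e + height ts\<close> vanishes only in the case where \<open>stack\<close> drops
  it.\<close>

lemma height_pos:
  assumes "ts \<in> lists columns" "ts \<noteq> []"
  shows "height ts > 0"
  using assms by (cases ts) (auto simp: columns_def odd_gaps_def split: if_splits)

lemma paired_stack: "ts \<in> lists columns \<Longrightarrow> paired (stack ts)"
proof (induction ts rule: stack.induct)
  case (2 d m e ts)
  then show ?case
    using height_pos[of ts] by (auto simp: columns_def odd_gaps_def)
qed simp

lemma gaps_stack: "ts \<in> lists columns \<Longrightarrow> gaps (stack ts) = ts"
  by (induction ts rule: stack.induct) auto

lemma height_gaps: "paired l \<Longrightarrow> height (gaps l) = top_size l"
  by (induction l rule: gaps.induct) auto

lemma gaps_in_columns: "paired l \<Longrightarrow> gaps l \<in> lists columns"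
  by (induction l rule: gaps.induct) (auto simp: columns_def odd_gaps_def)

lemma gaps_eq_Nil_iff [simp]: "gaps l = [] \<longleftrightarrow> l = []"
  by (cases l rule: gaps.cases) auto

text \<open>The gaps telescope back to the parts by \<open>height_gaps\<close>. For a list of two or
  more parts, \<open>y > 0\<close> excludes the branch of \<open>stack\<close> that drops a
  zero.\<close>

lemma stack_gaps: "paired l \<Longrightarrow> stack (gaps l) = l"
  by (induction l rule: gaps.induct) (auto simp: height_gaps)

lemma bij_betw_stack: "bij_betw stack (lists columns) {l. paired l}"
  by (rule bij_betw_byWitness[where f' = gaps])
    (use gaps_stack stack_gaps paired_stack gaps_in_columns in blast)+

lemma sum_list_stack: "sum_list (map fst (stack ts)) = columns_weight ts"
  by (induction ts rule: stack.induct) (auto simp: columns_weight_Cons column_weight_def)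

text \<open>Rounding the half up absorbs the dropped padding zero.\<close>

lemma length_stack: "(length (stack ts) + 1) div 2 = length ts"
  by (induction ts rule: stack.induct) auto

lemma columns_coeff_eq: "columns_coeff \<alpha> ts = \<alpha> ^ length (filter snd (stack ts))"
  by (induction ts rule: stack.induct) (auto simp: columns_coeff_def column_coeff_def)

section \<open>From the indexed definition of \<open>S2\<close> to the recursive one\<close>

lemma part_size_Suc: "part_size l (Suc i) = (if i < length l then fst (l ! i) else 0)"
  by (auto simp: part_size_def)

lemma overlined_Suc: "overlined l (Suc i) \<longleftrightarrow> i < length l \<and> snd (l ! i)"
  by (auto simp: overlined_def)

lemma ball_Suc: "(\<forall>i\<in>{1..n}. P i) \<longleftrightarrow> (\<forall>i<n. P (Suc i))"
  unfolding image_Suc_lessThan[symmetric] by auto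

lemma all_ge_1: "(\<forall>i\<ge>1. P i) \<longleftrightarrow> (\<forall>k. P (Suc k))"
  by (auto simp: Suc_le_eq gr0_conv_Suc)

lemma all_nat_split: "(\<forall>k. P k) \<longleftrightarrow> P 0 \<and> (\<forall>k. P (Suc k))"
  by (metis not0_implies_Suc)

abbreviation precedes :: "nat \<times> bool \<Rightarrow> nat \<times> bool \<Rightarrow> bool"
  where "precedes p q \<equiv> fst q \<le> fst p \<and> (snd p \<longrightarrow> fst q \<noteq> fst p)"

text \<open>Only the last copy of a size may be overlined, so an overlined part strictly exceeds all
  later ones. \<open>sorted_wrt\<close> unfolds along list constructors, which suits
  induction.\<close>

lemma overpartition_iff:
  "overpartition l \<longleftrightarrow> (\<forall>p\<in>set l. fst p > 0) \<and> sorted_wrt precedes l"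
proof -
  have "overpartition l \<longleftrightarrow> (\<forall>i<length l. fst (l ! i) > 0) \<and>
      (\<forall>i<length l. \<forall>j<length l. i \<le> j \<longrightarrow> fst (l ! j) \<le> fst (l ! i)) \<and>
      (\<forall>i<length l. \<forall>j<length l. snd (l ! i) \<and> i < j \<longrightarrow> fst (l ! j) \<noteq> fst (l ! i))"
    unfolding overpartition_def ball_Suc by (simp add: part_size_Suc overlined_Suc)
  also have "\<dots> \<longleftrightarrow> (\<forall>i<length l. fst (l ! i) > 0) \<and>
      (\<forall>i j. i < j \<longrightarrow> j < length l \<longrightarrow> precedes (l ! i) (l ! j))"
  proof (intro conj_cong refl iffI conjI allI impI)
    fix i j
    assume "i < length l" "j < length l" "i \<le> j"
      and "\<forall>i j. i < j \<longrightarrow> j < length l \<longrightarrow> precedes (l ! i) (l ! j)"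
    then show "fst (l ! j) \<le> fst (l ! i)"
      by (cases "i = j") auto
  qed auto
  finally show ?thesis
    unfolding sorted_wrt_iff_nth_less all_set_conv_all_nth .
qed

text \<open>The conditions of \<open>S2\<close> beyond \<open>overpartition\<close>, with positions
  counted from 0: odd indices become even positions.\<close>

definition gapped :: "marked_list \<Rightarrow> bool"
  where "gapped l \<longleftrightarrow> (\<forall>i<length l. snd (l ! i) \<longrightarrow> even i) \<and>
    (\<forall>k. 2 * k < length l \<longrightarrow>
      part_size l (2 * k + 2) + (if snd (l ! (2 * k)) then 2 else 1) \<le> part_size l (2 * k + 1))"

lemma S2_iff: "l \<in> S2 \<longleftrightarrow> overpartition l \<and> gapped l"
proof -
  \<comment> \<open>Moving \<open>y\<close> to the other side turns the integer differences into an
    inequality on naturals, free of truncated subtraction.\<close>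
  have gap: "int x - int y \<ge> 1 \<and> (m \<longrightarrow> int x - int y \<ge> 2) \<longleftrightarrow>
      y + (if m then 2 else 1) \<le> x" for x y m
    by auto
  have idx: "2 * Suc k = Suc (Suc (2 * k))"
      "2 * k + 1 = Suc (2 * k)" "2 * k + 2 = Suc (Suc (2 * k))" for k :: nat
    by simp_all
  show ?thesis
    unfolding S2_def gapped_def ball_Suc all_ge_1 gap idx diff_Suc_1 Suc_le_eq overlined_Suc
    by auto
qed

text \<open>Removing two leading parts preserves the parity of positions, so the tail inherits the
  same conditions.\<close>

lemma gapped_simps:
  "gapped []"
  "gapped [(x, m)] \<longleftrightarrow> (if m then 2 else 1) \<le> x"
  "gapped ((x, m) # (y, b) # r) \<longleftrightarrow>
    \<not> b \<and> y + (if m then 2 else 1) \<le> x \<and> gapped r"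
proof -
  show "gapped []"
    by (simp add: gapped_def)
  show "gapped [(x, m)] \<longleftrightarrow> (if m then 2 else 1) \<le> x"
    by (auto simp: gapped_def part_size_def)
  let ?l = "(x, m) # (y, b) # r"
  have "(\<forall>i<length ?l. snd (?l ! i) \<longrightarrow> even i) \<longleftrightarrow>
      \<not> b \<and> (\<forall>i<length r. snd (r ! i) \<longrightarrow> even i)"
    by (simp only: all_nat_split[of "\<lambda>i. i < length ?l \<longrightarrow> _ i"]
        all_nat_split[of "\<lambda>i. Suc i < length ?l \<longrightarrow> _ i"]) simp
  moreover have "(\<forall>k. 2 * k < length ?l \<longrightarrow>
      part_size ?l (2 * k + 2) + (if snd (?l ! (2 * k)) then 2 else 1) \<le> part_size ?l (2 * k + 1)) \<longleftrightarrow>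
      y + (if m then 2 else 1) \<le> x \<and> (\<forall>k. 2 * k < length r \<longrightarrow>
      part_size r (2 * k + 2) + (if snd (r ! (2 * k)) then 2 else 1) \<le> part_size r (2 * k + 1))"
    by (subst all_nat_split) (simp add: part_size_Suc)
  ultimately show "gapped ?l \<longleftrightarrow> \<not> b \<and> y + (if m then 2 else 1) \<le> x \<and> gapped r"
    unfolding gapped_def by blast
qed

lemma top_size_le_iff:
  "sorted_wrt precedes r \<Longrightarrow> top_size r \<le> y \<longleftrightarrow> (\<forall>p\<in>set r. fst p \<le> y)"
  by (cases r rule: top_size.cases) (auto intro: order_trans)

text \<open>The gap gives \<open>y < x\<close>, so anything bounded by \<open>y\<close> lies
  strictly below \<open>x\<close>, whether or not \<open>x\<close> is overlined. As \<open>y\<close>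
  is not overlined, later parts may equal it.\<close>

lemma overpartition_Cons_Cons:
  assumes "\<not> b" and gap: "y + (if m then 2 else 1) \<le> x"
  shows "overpartition ((x, m) # (y, b) # r) \<longleftrightarrow> y > 0 \<and> top_size r \<le> y \<and> overpartition r"
proof -
  have xy: "y < x"
    using gap by (simp split: if_splits)
  have "precedes (x, m) p" if "fst p \<le> y" for p
    using that xy by simp
  then have "(\<forall>p\<in>set r. fst p \<le> y) \<longrightarrow> (\<forall>p\<in>set r. precedes (x, m) p)"
    by blast
  moreover have "precedes (x, m) (y, b)" "precedes (y, b) p \<longleftrightarrow> fst p \<le> y" for p
    using assms(1) xy by simp_all
  moreover have "overpartition ((x, m) # (y, b) # r) \<longleftrightarrow> x > 0 \<and> y > 0 \<and> precedes (x, m) (y, b) \<and>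
      (\<forall>p\<in>set r. precedes (x, m) p) \<and> (\<forall>p\<in>set r. precedes (y, b) p) \<and> overpartition r"
    by (auto simp: overpartition_iff)
  moreover have "overpartition r \<Longrightarrow> top_size r \<le> y \<longleftrightarrow> (\<forall>p\<in>set r. fst p \<le> y)"
    unfolding overpartition_iff using top_size_le_iff by blast
  ultimately show ?thesis
    using xy by (metis gr_zeroI not_less_zero)
qed

lemma paired_iff: "paired l \<longleftrightarrow> overpartition l \<and> gapped l"
proof (induction l rule: paired.induct)
  case (3 x m y b r)
  show ?case
  \<comment> \<open>If this fails, both sides are false, as \<open>paired\<close> and
    \<open>gapped\<close> each demand it.\<close>
  proof (cases "\<not> b \<and> y + (if m then 2 else 1) \<le> x")
    case True
    with 3 overpartition_Cons_Cons[of b y m x r] show ?thesis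
      by (simp only: paired.simps gapped_simps) blast
  next
    case False
    then show ?thesis
      by (simp only: paired.simps gapped_simps) blast
  qed
qed (auto simp: overpartition_iff gapped_simps split: if_splits)

lemma S2_eq: "S2 = {l. paired l}"
  by (auto simp: S2_iff paired_iff)

section \<open>Statistics, finiteness and the final summation\<close>

lemma weight_eq: "weight l = sum_list (map fst l)"
proof -
  have "weight l = (\<Sum>i<length l. part_size l (Suc i))"
    unfolding weight_def by (rule sum.reindex_bij_witness[of _ Suc "\<lambda>i. i - 1"]) auto
  then show ?thesis
    by (simp add: part_size_def sum_list_sum_nth atLeast0LessThan)
qed

lemma num_overlined_eq: "num_overlined l = length (filter snd l)"
proof -
  have "bij_betw Suc {i. i < length l \<and> snd (l ! i)} {i\<in>{1..length l}. overlined l i}"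
    by (rule bij_betw_byWitness[where f' = "\<lambda>i. i - 1"]) (auto simp: overlined_def)
  from bij_betw_same_card[OF this] show ?thesis
    by (simp add: num_overlined_def length_filter_conv_card)
qed

text \<open>Parts are positive, so the weight bounds both their number and their sizes.\<close>

lemma finite_fibres_S2: "finite_fibres weight S2"
  unfolding finite_fibres_def
proof
  fix N
  have "l \<in> {l. set l \<subseteq> {..N} \<times> UNIV \<and> length l \<le> N}" if l: "l \<in> S2" "weight l = N" for l
  proof -
    have pos: "\<forall>p\<in>set l. fst p > 0"
      using l(1) by (simp add: S2_iff overpartition_iff)
    have "length l = sum_list (map (\<lambda>_. 1) l)"
      by (simp add: sum_list_triv)
    also have "\<dots> \<le> sum_list (map fst l)"
      by (rule sum_list_mono) (use pos in force)
    finally have "length l \<le> N"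
      using l(2) by (simp add: weight_eq)
    moreover have "fst p \<le> N" if "p \<in> set l" for p
      using that l(2) member_le_sum_list[of "fst p" "map fst l"] by (simp add: weight_eq)
    ultimately show ?thesis
      by auto
  qed
  then show "finite {l \<in> S2. weight l = N}"
    by (intro finite_subset[OF _ finite_lists_length_le[of "{..N} \<times> UNIV" N]]) auto
qed

text \<open>Each column weighs at least 1 because \<open>d\<close> is positive. This is the bound
  for grading by the number of columns.\<close>

lemma length_le_columns_weight:
  assumes "ts \<in> lists columns"
  shows "length ts \<le> columns_weight ts"
proof -
  have "(\<Sum>i<length ts. 1) \<le> (\<Sum>i<length ts. column_weight i (ts ! i))"
  proof (rule sum_mono)
    fix i assume "i \<in> {..<length ts}"
    with assms have "ts ! i \<in> columns"
      by auto
    then show "1 \<le> column_weight i (ts ! i)"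
      by (auto simp: columns_def odd_gaps_def column_weight_def split: if_splits)
  qed
  then show ?thesis
    by (simp add: columns_weight_def)
qed

lemma nat_ceiling_half: "nat \<lceil>real n / 2\<rceil> = (n + 1) div 2"
  using ceiling_divide_eq_div[of "int n" 2, where 'a = real] by simp

theorem theorem5p4:
  defines "lhs_term \<equiv> (\<lambda>l. var_a ^ num_overlined l * var_z ^ nat \<lceil>real (num_parts l) / 2\<rceil>
                             * var_q ^ weight l)"
    and "rhs_term \<equiv> (\<lambda>n. qpoch (- var_a * var_q) (var_q ^ 2) n * var_z ^ n * var_q ^ (n ^ 2)
                             * recip (qpoch var_q var_q (2 * n)))"
  shows "lhs_term summable_on S2 \<and> summable rhs_term \<and>
         (\<Sum>\<^sub>\<infinity>l\<in>S2. lhs_term l) = (\<Sum>n. rhs_term n)"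
proof -
  define \<alpha> \<zeta> :: "int poly poly" where "\<alpha> = [:[:0, 1:]:]" and "\<zeta> = [:0, 1:]"
  define c where "c l = \<alpha> ^ num_overlined l * \<zeta> ^ ((length l + 1) div 2)" for l :: marked_list
  \<comment> \<open>\<open>c\<close> transported along \<open>stack\<close>; the number of columns
    is the exponent of z.\<close>
  define c' where "c' ts = \<zeta> ^ length ts * columns_coeff \<alpha> ts" for ts
  have vars: "var_a = fps_const \<alpha>" "var_z = fps_const \<zeta>" "var_q = fps_X"
    by (simp_all add: var_a_def var_z_def var_q_def \<alpha>_def \<zeta>_def)
  have "lhs_term = (\<lambda>l. fps_const (c l) * fps_X ^ weight l)"
    unfolding lhs_term_def nat_ceiling_half num_parts_def vars c_def
    by (simp add: fps_const_power fun_eq_iff)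
  then have lhs: "(lhs_term has_sum gf c weight S2) S2"
    by (simp only: gf_has_sum[OF finite_fibres_S2])
  have stack: "c (stack ts) = c' ts" "weight (stack ts) = columns_weight ts" for ts
    by (simp_all only: c_def c'_def length_stack num_overlined_eq columns_coeff_eq
        weight_eq sum_list_stack mult.commute)
  note bij = bij_betw_stack[folded S2_eq]
  \<comment> \<open>Finiteness for lists of arbitrary length is pulled back from \<open>S2\<close>
    through the bijection.\<close>
  have fin: "finite_fibres columns_weight (lists columns)"
    using finite_fibres_reindex[OF bij, of weight] finite_fibres_S2 by (simp add: stack)
  have "gf c weight S2 = gf c' columns_weight (lists columns)"
    using gf_reindex[OF bij, of c weight] by (simp add: stack)
  moreover have "(\<lambda>n. gf c' columns_weight (column_lists n)) sums gf c' columns_weight (lists columns)"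
    by (rule gf_graded_sums[OF fin length_le_columns_weight])
  moreover have "gf c' columns_weight (column_lists n) = rhs_term n" for n
  proof -
    \<comment> \<open>The power of \<zeta> is constant on lists of length \<open>n\<close>; the
      offset 0 gives the form of \<open>gf_shift\<close>.\<close>
    have "gf c' columns_weight (column_lists n) =
        gf (\<lambda>ts. \<zeta> ^ n * columns_coeff \<alpha> ts) (\<lambda>ts. 0 + columns_weight ts) (column_lists n)"
      by (rule gf_cong) (auto simp: c'_def)
    also have "\<dots> = var_z ^ n * gf (columns_coeff \<alpha>) columns_weight (column_lists n)"
      unfolding gf_shift by (simp add: vars fps_const_power)
    \<comment> \<open>Inserting this factor 1 turns the identity with cleared denominators into the
      quotient in \<open>rhs_term\<close>.\<close>
    also have "\<dots> = var_z ^ n * (gf (columns_coeff \<alpha>) columns_weight (column_lists n) *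
        (qpoch var_q var_q (2 * n) * recip (qpoch var_q var_q (2 * n))))"
      by (simp add: recip_qpoch)
    also have "\<dots> = var_z ^ n * (gf (columns_coeff \<alpha>) columns_weight (column_lists n) *
        qpoch fps_X fps_X (2 * n)) * recip (qpoch var_q var_q (2 * n))"
      by (simp only: mult.assoc vars)
    also have "\<dots> = rhs_term n"
      unfolding gf_column_lists rhs_term_def vars by (simp only: mult_ac)
    finally show ?thesis .
  qed
  ultimately have "rhs_term sums gf c weight S2"
    by simp
  then have "summable rhs_term" "(\<Sum>n. rhs_term n) = gf c weight S2"
    by (simp_all only: sums_iff)
  moreover have "lhs_term summable_on S2"
    unfolding summable_on_def using lhs by blast
  ultimately show ?thesis
    using infsumI[OF lhs] by (simp only: simp_thms)
qed

end
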